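(* Let $T_h$ be a tetrahedral mesh of the computational domain $\Omega\subset\mathbb{R}^3$ with characteristic size $h$, and let $\{\mathbf{x}_i\}$ denote the barycenters of the elements of $T_h$. For a target point $\mathbf{x}_i$, let $\{K\}$ be the set of source elements associated with $\mathbf{x}_i$, where the element $K$ occupies the region $\Omega_K$, has volume $|\Omega_K|$ and barycenter $\mathbf{y}_c=\mathbf{y}_c(K)$, and the source elements are split into the near-field domain $\Omega_N$ (neighbor elements) and the far-field domain $\Omega_F$ (non-neighbor elements). Let $G(\mathbf{x},\mathbf{y})=\frac{1}{4\pi|\mathbf{x}-\mathbf{y}|}$ and let $p\ge 0$ be an integer. Assume: (i) the treecode algorithm computes the near-field interactions exactly; (ii) the far-field contributions are approximated using a $p$-th order multipole expansion in Cartesian coordinates; (iii) the source function $f$ is bounded above by a positive constant $F>0$ in $\Omega$. Then there is a constant $C$ depending on $f$ such that the error at the target point $\mathbf{x}_i$ arising from the multipole approximation of the far-field interactions, $$E(\mathbf{x}_i)=\left|\int_{\Omega}G(\mathbf{x}_i,\mathbf{y})f(\mathbf{y})\,d\mathbf{y}-\left[\int_{\Omega_N}G(\mathbf{x}_i,\mathbf{y})f(\mathbf{y})\,d\mathbf{y}+\sum_{K\in\Omega_F}\int_{\Omega_K}\sum_{\|\mathbf{k}\|=0}^{p}a^{\mathbf{k}}(\mathbf{x}_i,\mathbf{y}_c)(\mathbf{y}-\mathbf{y}_c)^{\mathbf{k}}f(\mathbf{y})\,d\mathbf{y}\right]\right|,$$ satisfies $$E(\mathbf{x}_i)\le C\left|\sum_{K\in\Omega_F}\frac{r_K^{p+1}\,|\Omega_K|}{R_K(1-r_K)}\right|.$$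 (A term with $r_K=1$ is read as $+\infty$.)
   Context: Problem: one evaluates $u(\mathbf{x})=\int_\Omega G(\mathbf{x},\mathbf{y})f(\mathbf{y})\,d\mathbf{y}$ over a bounded (truncated) domain $\Omega\subset\mathbb{R}^3$ at the target points $\mathbf{x}=\mathbf{x}_i$. Source elements: the mesh is organized in a hierarchical (octree) structure obtained by uniform refinement, in which each tetrahedron is split into eight. For a given target point $\mathbf{x}_i$, the source elements are tetrahedra, possibly at different levels of the tree, that together partition $\Omega$. $\Omega_K$ is the region occupied by the element $K$. Near and far field: for a source element $K$ with barycenter $\mathbf{y}_c$, let $r_y$ be the maximum radius of $K$ (the maximum of $|\mathbf{y}-\mathbf{y}_c|$ over $\mathbf{y}\in K$) and let $R_K=|\mathbf{x}_i-\mathbf{y}_c|$ be the distance between the barycenter of $K$ and the target point. Put $r_K=r_y/R_K$. If $r_K\le 1$, then $K$ is a non-neighbor element and belongs to the far-field domain $\Omega_F$; otherwise $K$ is a neighbor element and belongs to the near-field domain $\Omega_N$. Thus $\Omega$ is the union of $\Omega_N$ and $\Omega_F$. The notation $K\in\Omega_F$ means that $K$ is a non-neighbor element. Multi-index notation: $\mathbf{k}=(k_1,k_2,k_3)$ with $k_i\in\mathbb{N}$ (including $0$), $\|\mathbf{k}\|=k_1+k_2+k_3$, $\mathbf{k}!=k_1!\,k_2!\,k_3!$, $\mathbf{y}^{\mathbf{k}}=y_1^{k_1}y_2^{k_2}y_3^{k_3}$, $D^{\mathbf{k}}_{\mathbf{y}}=D_{y_1}^{k_1}D_{y_2}^{k_2}D_{y_3}^{k_3}$.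 The $p$-th order multipole expansion in Cartesian coordinates on $K$ replaces $G(\mathbf{x}_i,\mathbf{y})$ by $\sum_{\|\mathbf{k}\|=0}^{p}a^{\mathbf{k}}(\mathbf{x}_i,\mathbf{y}_c)(\mathbf{y}-\mathbf{y}_c)^{\mathbf{k}}$, where $a^{\mathbf{k}}(\mathbf{x}_i,\mathbf{y}_c)=\frac{1}{\mathbf{k}!}D^{\mathbf{k}}_{\mathbf{y}}G(\mathbf{x}_i,\mathbf{y})\big|_{\mathbf{y}=\mathbf{y}_c}$.
   Formalization: Assumption (iii) is read as a two-sided bound |f| ≤ F on Ω (with f measurable): if f is only bounded above, the integrals may diverge, or no constant depending on f alone may exist. *)

theory Defs
  imports "HOL-Analysis.Analysis"
begin

text \<open>Elements are closed nondegenerate tetrahedra, so distinct elements may share boundary points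
  and only their interiors are disjoint. In particular \<open>\<Omega>\<close> below is the union of the closed elements.
  No conformity is required, because source elements of different levels need not meet face to face.\<close>

definition tet_partition :: "(real^3) set set \<Rightarrow> (real^3) set \<Rightarrow> bool" where
  "tet_partition \<T> \<Omega> \<longleftrightarrow>
     finite \<T> \<and> (\<forall>K\<in>\<T>. 3 simplex K) \<and>
     pairwise (\<lambda>K L. interior K \<inter> interior L = {}) \<T> \<and> \<Union>\<T> = \<Omega>"

definition tet_mesh :: "(real^3) set \<Rightarrow> real \<Rightarrow> (real^3) set set \<Rightarrow> bool" where
  "tet_mesh \<Omega> h \<T> \<longleftrightarrow> tet_partition \<T> \<Omega> \<and> h = (MAX K\<in>\<T>. diameter K)"

definition uniform_refinement :: "(real^3) set set \<Rightarrow> (real^3) set set \<Rightarrow> bool" where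
  "uniform_refinement \<T> \<T>' \<longleftrightarrow>
     (\<forall>K\<in>\<T>. tet_partition {K'\<in>\<T>'. K' \<subseteq> K} K \<and> card {K'\<in>\<T>'. K' \<subseteq> K} = 8) \<and>
     (\<forall>K'\<in>\<T>'. \<exists>K\<in>\<T>. K' \<subseteq> K)"

definition octree ::
  "(real^3) set \<Rightarrow> (real^3) set set \<Rightarrow> nat \<Rightarrow> (nat \<Rightarrow> (real^3) set set) \<Rightarrow> bool" where
  "octree \<Omega> \<T> m level \<longleftrightarrow>
     tet_partition (level 0) \<Omega> \<and>
     (\<forall>j<m. uniform_refinement (level j) (level (Suc j))) \<and>
     level m = \<T>"

definition source_elements ::
  "(real^3) set \<Rightarrow> nat \<Rightarrow> (nat \<Rightarrow> (real^3) set set) \<Rightarrow> (real^3) set set \<Rightarrow> bool" where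
  "source_elements \<Omega> m level \<S> \<longleftrightarrow> \<S> \<subseteq> (\<Union>j\<le>m. level j) \<and> tet_partition \<S> \<Omega>"

text \<open>The extreme points of a tetrahedron are its four vertices.\<close>

definition barycenter :: "(real^3) set \<Rightarrow> real^3" where
  "barycenter K = (1/4) *\<^sub>R (\<Sum>v | v extreme_point_of K. v)"

definition max_radius :: "(real^3) set \<Rightarrow> real" where
  "max_radius K = (SUP y\<in>K. norm (y - barycenter K))"

definition target_dist :: "real^3 \<Rightarrow> (real^3) set \<Rightarrow> real" where
  "target_dist x K = norm (x - barycenter K)"

definition radius_ratio :: "real^3 \<Rightarrow> (real^3) set \<Rightarrow> real" where
  "radius_ratio x K = max_radius K / target_dist x K"

text \<open>If the target point is the barycenter of \<open>K\<close>, the ratio is \<open>+\<infinity>\<close> on paper and \<open>K\<close> is a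
  neighbor, whereas division by zero makes \<^const>\<open>radius_ratio\<close> equal to \<open>0\<close>. Hence the guard
  \<open>target_dist x K > 0\<close>.\<close>

definition far_elements :: "real^3 \<Rightarrow> (real^3) set set \<Rightarrow> (real^3) set set" where
  "far_elements x \<S> = {K\<in>\<S>. target_dist x K > 0 \<and> radius_ratio x K \<le> 1}"

definition near_elements :: "real^3 \<Rightarrow> (real^3) set set \<Rightarrow> (real^3) set set" where
  "near_elements x \<S> = \<S> - far_elements x \<S>"

definition G :: "real^3 \<Rightarrow> real^3 \<Rightarrow> real" where
  "G x y = 1 / (4 * pi * norm (x - y))"

definition mi_order :: "nat^3 \<Rightarrow> nat" where
  "mi_order k = (\<Sum>i\<in>UNIV. k $ i)"

definition mi_fact :: "nat^3 \<Rightarrow> real" where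
  "mi_fact k = (\<Prod>i\<in>UNIV. fact (k $ i))"

definition mi_power :: "real^3 \<Rightarrow> nat^3 \<Rightarrow> real" where
  "mi_power y k = (\<Prod>i\<in>UNIV. (y $ i) ^ (k $ i))"

definition partial :: "3 \<Rightarrow> (real^3 \<Rightarrow> real) \<Rightarrow> real^3 \<Rightarrow> real" where
  "partial i g y = deriv (\<lambda>t. g (y + t *\<^sub>R axis i 1)) 0"

definition mi_deriv :: "nat^3 \<Rightarrow> (real^3 \<Rightarrow> real) \<Rightarrow> real^3 \<Rightarrow> real" where
  "mi_deriv k g = (partial 1 ^^ (k $ 1)) ((partial 2 ^^ (k $ 2)) ((partial 3 ^^ (k $ 3)) g))"

definition multipole_coeff :: "nat^3 \<Rightarrow> real^3 \<Rightarrow> real^3 \<Rightarrow> real" where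
  "multipole_coeff k x yc = (1 / mi_fact k) * mi_deriv k (G x) yc"

definition multipole :: "nat \<Rightarrow> real^3 \<Rightarrow> real^3 \<Rightarrow> real^3 \<Rightarrow> real" where
  "multipole p x yc y = (\<Sum>k | mi_order k \<le> p. multipole_coeff k x yc * mi_power (y - yc) k)"

definition treecode ::
  "nat \<Rightarrow> (real^3 \<Rightarrow> real) \<Rightarrow> (real^3) set set \<Rightarrow> real^3 \<Rightarrow> real" where
  "treecode p f \<S> x =
     (LINT y : \<Union>(near_elements x \<S>) | lebesgue. G x y * f y) +
     (\<Sum>K\<in>far_elements x \<S>. LINT y : K | lebesgue. multipole p x (barycenter K) y * f y)"

definition treecode_error ::
  "nat \<Rightarrow> (real^3) set \<Rightarrow> (real^3 \<Rightarrow> real) \<Rightarrow> (real^3) set set \<Rightarrow> real^3 \<Rightarrow> real" where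
  "treecode_error p \<Omega> f \<S> x = \<bar>(LINT y : \<Omega> | lebesgue. G x y * f y) - treecode p f \<S> x\<bar>"

definition bound_term :: "nat \<Rightarrow> real^3 \<Rightarrow> (real^3) set \<Rightarrow> ereal" where
  "bound_term p x K =
     (if radius_ratio x K = 1 then \<infinity>
      else ereal (radius_ratio x K ^ (p + 1) * measure lebesgue K /
                  (target_dist x K * (1 - radius_ratio x K))))"

end

theory Submission
  imports Defs
begin

text \<open>Fix a far element \<open>K\<close> with barycenter \<open>yc\<close>, put \<open>R = |x - yc|\<close>, and let \<open>r < 1\<close> be its radius ratio.
  For \<open>y \<in> K\<close> let \<open>s = |y - yc| / R \<le> r\<close> and let \<open>\<theta>\<close> be the angle at \<open>yc\<close> between \<open>x\<close> and \<open>y\<close>. The Legendre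
  expansion \<open>1 / |x - y| = (\<Sum>n. s ^ n * P\<^sub>n (cos \<theta>)) / R\<close> converges because \<open>s < 1\<close>, and
  \<open>|P\<^sub>n (cos \<theta>)| \<le> 1\<close>. Its partial sum of degree \<open>p\<close> is, up to the factor \<open>4 * pi\<close>, the multipole
  expansion, so the pointwise error is at most the geometric tail \<open>r ^ (p + 1) / (4 * pi * R * (1 - r))\<close>.
  Integrating against \<open>f\<close> over \<open>K\<close> costs a factor \<open>F * |K|\<close>, and summing over the far elements gives
  the claim with \<open>C = F / (4 * pi)\<close>. If some far element has \<open>r = 1\<close>, the bound is infinite.

  The Legendre coefficients and their bound come from factoring \<open>|1 - z|\<close> over the complex numbers
  (\<open>legendre_term_sums\<close>, \<open>legendre_term_bound\<close>, \<open>inverse_dist_expansion\<close>). The multipole expansion is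
  defined through iterated partial derivatives. It is matched with the series by restricting the kernel to
  the line through \<open>yc\<close> and \<open>y\<close>: the homogeneous parts of the Taylor polynomial are, up to factorials,
  successive derivatives along that line (\<open>taylor_layer_deriv\<close>). This requires the partial derivatives of
  the kernel to exist at all orders and to commute (\<open>kernel_algebra_partial\<close>, \<open>partial_commute\<close>). The two
  descriptions meet in \<open>multipole_remainder\<close>.

  Splitting the integral over \<open>\<Omega>\<close> into element integrals uses that the kernel is
  integrable near its singularity (\<open>G_integrable_on_cball\<close>) and that elements overlap in null sets
  (\<open>set_integral_nonoverlapping\<close>).\<close>

section \<open>Partial derivatives of the kernel\<close>

text \<open>A class of functions that contains \<open>G x\<close>, is closed under partial derivatives, and in which partial
derivatives commute. The last rule identifies functions that agree off \<open>x\<close>: the derivative of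
\<open>1 / |y - x|\<close> has no meaningful value at \<open>x\<close>, so the product and chain rules hold only off that point.\<close>

inductive kernel_algebra :: "real^3 \<Rightarrow> (real^3 \<Rightarrow> real) \<Rightarrow> bool" for x where
  const: "kernel_algebra x (\<lambda>y. c)"
| coord: "kernel_algebra x (\<lambda>y. y $ i)"
| inv_dist: "kernel_algebra x (\<lambda>y. inverse (norm (y - x)))"
| add: "kernel_algebra x f \<Longrightarrow> kernel_algebra x g \<Longrightarrow> kernel_algebra x (\<lambda>y. f y + g y)"
| mult: "kernel_algebra x f \<Longrightarrow> kernel_algebra x g \<Longrightarrow> kernel_algebra x (\<lambda>y. f y * g y)"
| cong: "kernel_algebra x f \<Longrightarrow> (\<And>y. y \<noteq> x \<Longrightarrow> g y = f y) \<Longrightarrow> kernel_algebra x g"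

lemma partial_eq_derivative:
  assumes "(f has_derivative f') (at y)"
  shows "partial i f y = f' (axis i 1)"
proof -
  have "((\<lambda>t. f (y + t *\<^sub>R axis i 1)) has_derivative (\<lambda>t. f' (t *\<^sub>R axis i 1))) (at 0)"
    by (rule has_derivative_compose[where f="\<lambda>t. y + t *\<^sub>R axis i 1"])
      (auto intro!: derivative_eq_intros simp: assms)
  moreover have "f' (t *\<^sub>R axis i 1) = f' (axis i 1) * t" for t
    using linear_scale[OF has_derivative_linear[OF assms]] by simp
  ultimately show ?thesis
    unfolding partial_def by (intro DERIV_imp_deriv) (simp add: has_field_derivative_def)
qed

lemma eventually_eq_off_point:
  fixes x y :: "real^3"
  assumes "\<And>y. y \<noteq> x \<Longrightarrow> f y = g y" and "y \<noteq> x"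
  shows "\<forall>\<^sub>F t in nhds 0. f (y + t *\<^sub>R b) = g (y + t *\<^sub>R b)"
proof -
  have "((\<lambda>t. y + t *\<^sub>R b) \<longlongrightarrow> y + 0 *\<^sub>R b) (nhds 0)"
    by (intro tendsto_intros filterlim_ident)
  then have "\<forall>\<^sub>F t in nhds (0::real). y + t *\<^sub>R b \<noteq> x"
    using assms(2) by (intro tendsto_imp_eventually_ne) auto
  then show ?thesis by eventually_elim (use assms(1) in auto)
qed

lemma partial_cong:
  assumes "\<And>y. y \<noteq> x \<Longrightarrow> f y = g y" and "y \<noteq> x"
  shows "partial i f y = partial i g y"
  unfolding partial_def by (intro deriv_cong_ev eventually_eq_off_point[OF assms]) auto

lemma has_derivative_inverse_dist:
  fixes x y :: "real^3"
  assumes "y \<noteq> x"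
  shows "((\<lambda>y. inverse (norm (y - x))) has_derivative
    (\<lambda>v. - (inverse (norm (y - x)) ^ 3) * ((y - x) \<bullet> v))) (at y)"
proof -
  have "((\<lambda>y. norm (y - x)) has_derivative (\<lambda>v. v \<bullet> sgn (y - x))) (at y)"
  proof -
    have "((\<lambda>y. y - x) has_derivative (\<lambda>v. v)) (at y)"
      by (auto intro!: derivative_eq_intros)
    moreover have "(norm has_derivative (\<lambda>v. v \<bullet> sgn (y - x))) (at (y - x))"
      using has_derivative_norm[of "y - x"] assms by simp
    ultimately show ?thesis by (rule has_derivative_compose)
  qed
  from Deriv.has_derivative_inverse[OF _ this] show ?thesis
    using assms by (simp add: sgn_div_norm power3_eq_cube inner_commute divide_simps)
qed

lemma kernel_algebra_differentiable:
  assumes "kernel_algebra x f" and "y \<noteq> x"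
  shows "f differentiable (at y)"
  using assms
proof induction
  case (coord i)
  show ?case
    using bounded_linear_imp_differentiable[OF bounded_linear_vec_nth] by blast
next
  case inv_dist
  then show ?case using has_derivative_inverse_dist differentiableI by blast
next
  case (cong f g)
  have "\<forall>\<^sub>F z in nhds y. z \<noteq> x"
    using cong.prems by (simp add: t1_space_nhds)
  then obtain S where S: "open S" "y \<in> S" "\<And>z. z \<in> S \<Longrightarrow> z \<noteq> x"
    unfolding eventually_nhds by blast
  from cong obtain f' where "(f has_derivative f') (at y)"
    by (auto simp: differentiable_def)
  then have "(g has_derivative f') (at y)"
    by (rule has_derivative_transform_within_open[OF _ S(1,2)]) (use S cong.hyps in auto)
  then show ?case by (auto simp: differentiable_def)
qed (auto intro: differentiable_add differentiable_mult)

lemma kernel_algebra_has_derivative: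
  assumes "kernel_algebra x f" and "y \<noteq> x"
  shows "(f has_derivative (\<lambda>v. \<Sum>i\<in>UNIV. v $ i * partial i f y)) (at y)"
proof -
  obtain f' where f': "(f has_derivative f') (at y)"
    using kernel_algebra_differentiable[OF assms] by (auto simp: differentiable_def)
  have "f' v = (\<Sum>i\<in>UNIV. v $ i * partial i f y)" for v
  proof -
    have "f' v = f' (\<Sum>i\<in>UNIV. v $ i *\<^sub>R axis i 1)"
      using basis_expansion[of v] by (simp add: scalar_mult_eq_scaleR)
    then show ?thesis
      using f' by (simp add: linear_sum linear_scale has_derivative_linear partial_eq_derivative)
  qed
  then have "f' = (\<lambda>v. \<Sum>i\<in>UNIV. v $ i * partial i f y)" by blast
  with f' show ?thesis by metis
qed

lemma partial_const: "partial i (\<lambda>y. c) y = 0"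
  by (simp add: partial_def)

lemma partial_coord: "partial i (\<lambda>y. y $ j) y = axis i 1 $ j"
  by (metis bounded_linear_imp_has_derivative bounded_linear_vec_nth partial_eq_derivative)

lemma partial_inverse_dist:
  "y \<noteq> x \<Longrightarrow> partial i (\<lambda>y. inverse (norm (y - x))) y =
    - (inverse (norm (y - x)) ^ 3) * (y $ i - x $ i)"
  by (simp add: partial_eq_derivative[OF has_derivative_inverse_dist] inner_axis)

lemma partial_add:
  assumes "kernel_algebra x f" "kernel_algebra x g" "y \<noteq> x"
  shows "partial i (\<lambda>y. f y + g y) y = partial i f y + partial i g y"
  using has_derivative_add[OF assms(1,2)[THEN kernel_algebra_has_derivative[OF _ assms(3)]],
      THEN partial_eq_derivative]
  by (simp add: axis_def if_distrib if_distribR cong: if_cong)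

lemma partial_mult:
  assumes "kernel_algebra x f" "kernel_algebra x g" "y \<noteq> x"
  shows "partial i (\<lambda>y. f y * g y) y = f y * partial i g y + g y * partial i f y"
  using has_derivative_mult[OF assms(1,2)[THEN kernel_algebra_has_derivative[OF _ assms(3)]],
      THEN partial_eq_derivative]
  by (simp add: axis_def if_distrib if_distribR cong: if_cong)

lemma kernel_algebra_partial:
  assumes "kernel_algebra x f"
  shows "kernel_algebra x (partial i f)"
  using assms
proof induction
  case (const c)
  show ?case by (rule kernel_algebra.cong[OF kernel_algebra.const]) (simp add: partial_const)
next
  case (coord j)
  show ?case by (rule kernel_algebra.cong[OF kernel_algebra.const]) (simp add: partial_coord)
next
  case inv_dist
  let ?r = "\<lambda>y. inverse (norm (y - x))"
  have "kernel_algebra x (\<lambda>y. (-1) * (?r y * (?r y * ?r y)) * (y $ i + (- x $ i)))"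
    by (intro kernel_algebra.intros(1-5))
  then show ?case
    by (rule kernel_algebra.cong) (simp add: partial_inverse_dist power3_eq_cube mult.assoc)
next
  case (add f g)
  show ?case
    by (rule kernel_algebra.cong[OF kernel_algebra.add[OF add.IH]]) (simp add: partial_add[OF add.hyps])
next
  case (mult f g)
  show ?case
    by (rule kernel_algebra.cong[OF kernel_algebra.add[OF kernel_algebra.mult[OF mult.hyps(1) mult.IH(2)]
      kernel_algebra.mult[OF mult.hyps(2) mult.IH(1)]]]) (simp add: partial_mult[OF mult.hyps])
next
  case (cong f g)
  show ?case by (rule kernel_algebra.cong[OF cong.IH]) (use partial_cong cong.hyps in metis)
qed

text \<open>By induction over the class: once the case \<open>1 / |y - x|\<close> is computed, whose Hessian is visibly
symmetric, the sum and product rules carry symmetry through.\<close>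

lemma partial_commute:
  assumes "kernel_algebra x f" and "y \<noteq> x"
  shows "partial i (partial j f) y = partial j (partial i f) y"
  using assms
proof (induction arbitrary: y)
  case (const c)
  then show ?case by (simp add: partial_const[abs_def])
next
  case (coord k)
  then show ?case by (simp add: partial_coord[abs_def] partial_const[abs_def])
next
  case inv_dist
  let ?r = "\<lambda>y. inverse (norm (y - x))"
  have D: "((\<lambda>y. - (?r y ^ 3) * (y $ j - x $ j)) has_derivative
     (\<lambda>v. - (?r y ^ 3) * v $ j + (3 * ?r y ^ 5 * ((y - x) \<bullet> v)) * (y $ j - x $ j))) (at y)" for j
    by (rule derivative_eq_intros has_derivative_inverse_dist[OF inv_dist] refl
       bounded_linear_imp_has_derivative[OF bounded_linear_vec_nth])+
      (simp add: fun_eq_iff algebra_simps eval_nat_numeral)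
  have H: "partial i (partial j ?r) y =
     - (?r y ^ 3) * axis i 1 $ j + 3 * ?r y ^ 5 * (y $ i - x $ i) * (y $ j - x $ j)" for i j
  proof -
    have "partial i (partial j ?r) y = partial i (\<lambda>y. - (?r y ^ 3) * (y $ j - x $ j)) y"
      by (rule partial_cong[OF _ inv_dist]) (simp add: partial_inverse_dist)
    also have "\<dots> = - (?r y ^ 3) * axis i 1 $ j + 3 * ?r y ^ 5 * (y $ i - x $ i) * (y $ j - x $ j)"
      by (subst partial_eq_derivative[OF D]) (simp add: inner_axis)
    finally show ?thesis .
  qed
  show ?case unfolding H by (simp add: axis_def eq_commute[of i j] mult_ac)
next
  case (add f g)
  have H: "partial i (partial j (\<lambda>y. f y + g y)) y =
    partial i (partial j f) y + partial i (partial j g) y" for i j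
  proof -
    have "partial i (partial j (\<lambda>y. f y + g y)) y = partial i (\<lambda>y. partial j f y + partial j g y) y"
      by (rule partial_cong[OF _ add.prems]) (rule partial_add[OF add.hyps])
    also have "\<dots> = partial i (partial j f) y + partial i (partial j g) y"
      by (rule partial_add[OF add.hyps[THEN kernel_algebra_partial] add.prems])
    finally show ?thesis .
  qed
  show ?case unfolding H using add.IH add.prems by simp
next
  case (mult f g)
  note A = kernel_algebra_partial kernel_algebra.mult mult.hyps
  have H: "partial i (partial j (\<lambda>y. f y * g y)) y = f y * partial i (partial j g) y +
    partial j g y * partial i f y + (g y * partial i (partial j f) y + partial j f y * partial i g y)" for i j
  proof -
    have "partial i (partial j (\<lambda>y. f y * g y)) y
      = partial i (\<lambda>y. f y * partial j g y + g y * partial j f y) y"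
      by (rule partial_cong[OF _ mult.prems]) (rule partial_mult[OF mult.hyps])
    also have "\<dots> = partial i (\<lambda>y. f y * partial j g y) y + partial i (\<lambda>y. g y * partial j f y) y"
      by (rule partial_add[OF _ _ mult.prems]) (intro A)+
    also have "partial i (\<lambda>y. f y * partial j g y) y = f y * partial i (partial j g) y + partial j g y * partial i f y"
      by (rule partial_mult[OF _ _ mult.prems]) (intro A)+
    also have "partial i (\<lambda>y. g y * partial j f y) y = g y * partial i (partial j f) y + partial j f y * partial i g y"
      by (rule partial_mult[OF _ _ mult.prems]) (intro A)+
    finally show ?thesis .
  qed
  have "partial i (partial j f) y = partial j (partial i f) y" "partial i (partial j g) y = partial j (partial i g) y"
    using mult.IH mult.prems by blast+
  then show ?case unfolding H by (simp add: algebra_simps)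
next
  case (cong f g)
  have "partial i (partial j g) y = partial i (partial j f) y" for i j
    by (rule partial_cong[OF partial_cong cong.prems]) (use cong.hyps in auto)
  with cong show ?case by simp
qed

lemma kernel_algebra_funpow:
  "kernel_algebra x f \<Longrightarrow> kernel_algebra x ((partial i ^^ n) f)"
  by (induction n) (auto intro: kernel_algebra_partial)

lemma kernel_algebra_mi_deriv: "kernel_algebra x f \<Longrightarrow> kernel_algebra x (mi_deriv k f)"
  unfolding mi_deriv_def by (intro kernel_algebra_funpow)

lemma partial_funpow_cong:
  assumes "\<And>y. y \<noteq> x \<Longrightarrow> f y = g y" and "y \<noteq> x"
  shows "(partial i ^^ n) f y = (partial i ^^ n) g y"
  using assms(2)
proof (induction n arbitrary: y)
  case (Suc n)
  have "partial i ((partial i ^^ n) f) y = partial i ((partial i ^^ n) g) y"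
    by (rule partial_cong[OF _ Suc.prems]) (rule Suc.IH)
  then show ?case by simp
qed (simp add: assms(1))

lemma partial_funpow_commute:
  assumes "kernel_algebra x f" and "y \<noteq> x"
  shows "partial i ((partial j ^^ n) f) y = (partial j ^^ n) (partial i f) y"
  using assms(2)
proof (induction n arbitrary: y)
  case (Suc n)
  have "partial i ((partial j ^^ Suc n) f) y = partial j (partial i ((partial j ^^ n) f)) y"
    using partial_commute[OF kernel_algebra_funpow[OF assms(1)] Suc.prems] by simp
  also have "\<dots> = partial j ((partial j ^^ n) (partial i f)) y"
    by (rule partial_cong[OF _ Suc.prems]) (rule Suc.IH)
  finally show ?case by simp
qed auto

text \<open>\<^const>\<open>mi_deriv\<close> applies the partial derivatives in the order third, second, first. A further
derivative in direction \<open>i\<close> therefore has to be moved inward past those in directions below \<open>i\<close>.\<close>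

lemma partial_mi_deriv:
  assumes f: "kernel_algebra x f" and y: "y \<noteq> x"
  shows "partial i (mi_deriv k f) y = mi_deriv (k + axis i 1) f y"
proof -
  let ?D3 = "(partial 3 ^^ (k $ 3)) f" 
  have "(axis i 1 :: nat^3) $ j = (if i = j then 1 else 0)" for i j by (simp add: axis_def)
  note axis_Suc = this[unfolded One_nat_def]
  consider "i = 1" | "i = 2" | "i = 3" using exhaust_3 by blast
  then show ?thesis
  proof cases
    case 1 then show ?thesis by (simp add: mi_deriv_def axis_Suc)
  next
    case 2
    have "partial 2 (mi_deriv k f) y = (partial 1 ^^ k $ 1) (partial 2 ((partial 2 ^^ k $ 2) ?D3)) y"
      unfolding mi_deriv_def by (intro partial_funpow_commute[OF _ y] kernel_algebra_funpow f)
    with 2 show ?thesis by (simp add: mi_deriv_def axis_Suc)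
  next
    case 3
    have "partial 3 (mi_deriv k f) y = (partial 1 ^^ k $ 1) (partial 3 ((partial 2 ^^ k $ 2) ?D3)) y"
      unfolding mi_deriv_def by (intro partial_funpow_commute[OF _ y] kernel_algebra_funpow f)
    also have "\<dots> = (partial 1 ^^ k $ 1) ((partial 2 ^^ k $ 2) (partial 3 ?D3)) y"
      by (rule partial_funpow_cong[OF _ y], rule partial_funpow_commute) (auto intro: kernel_algebra_funpow f)
    finally show ?thesis using 3 by (simp add: mi_deriv_def axis_Suc)
  qed
qed

section \<open>Taylor polynomials along a line\<close>

text \<open>The homogeneous part of degree \<open>n\<close> in \<open>b\<close> of the Taylor polynomial of \<open>f\<close> at \<open>y\<close>, evaluated at \<open>y + b\<close>.\<close>

definition taylor_layer :: "(real^3 \<Rightarrow> real) \<Rightarrow> nat \<Rightarrow> real^3 \<Rightarrow> real^3 \<Rightarrow> real" where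
  "taylor_layer f n y b = (\<Sum>k | mi_order k = n. mi_deriv k f y / mi_fact k * mi_power b k)"

lemma finite_mi_order_le: "finite {k. mi_order k \<le> n}"
proof (rule finite_subset)
  show "{k. mi_order k \<le> n} \<subseteq> {k. \<forall>i. k $ i \<in> {..n}}"
  proof clarsimp
    fix k i assume "mi_order k \<le> n"
    then show "k $ i \<le> n"
      using member_le_sum[of i UNIV "\<lambda>i. k $ i"] by (simp add: mi_order_def)
  qed
  have "{k :: nat^3. \<forall>i. k $ i \<in> {..n}} = vec_lambda ` (UNIV \<rightarrow> {..n})"
  proof (intro equalityI subsetI)
    fix k :: "nat^3" assume "k \<in> {k. \<forall>i. k $ i \<in> {..n}}"
    then show "k \<in> vec_lambda ` (UNIV \<rightarrow> {..n})" by (intro image_eqI[of _ _ "vec_nth k"]) auto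
  qed auto
  moreover have "finite (UNIV \<rightarrow> {..n} :: (3 \<Rightarrow> nat) set)"
    using finite_PiE[of "UNIV :: 3 set" "\<lambda>_. {..n}"] by (simp add: PiE_UNIV_domain)
  ultimately show "finite {k :: nat^3. \<forall>i. k $ i \<in> {..n}}" by simp
qed

lemma finite_mi_order_eq: "finite {k. mi_order k = n}"
  by (rule finite_subset[OF _ finite_mi_order_le[of n]]) auto

lemma mi_order_add_axis: "mi_order (k + axis i 1) = Suc (mi_order k)"
  by (simp add: mi_order_def sum.distrib axis_def)

lemma mi_fact_add_axis: "mi_fact (k + axis i 1) = real (Suc (k $ i)) * mi_fact k"
proof -
  have "mi_fact (k + axis i 1) = (\<Prod>j\<in>UNIV. (if j = i then real (Suc (k $ i)) else 1) * fact (k $ j))"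
    unfolding mi_fact_def by (rule prod.cong) (auto simp: axis_def)
  then show ?thesis by (simp add: prod.distrib mi_fact_def)
qed

lemma mi_power_add_axis: "mi_power b (k + axis i 1) = b $ i * mi_power b k"
proof -
  have "mi_power b (k + axis i 1) = (\<Prod>j\<in>UNIV. (if j = i then b $ i else 1) * (b $ j) ^ (k $ j))"
    unfolding mi_power_def by (rule prod.cong) (auto simp: axis_def)
  then show ?thesis by (simp add: prod.distrib mi_power_def)
qed

text \<open>The multi-indices of order \<open>n + 1\<close> missed by the shift \<open>k \<mapsto> k + e\<^sub>i\<close> are those with \<open>k\<^sub>i = 0\<close>, and
their terms on the right vanish.\<close>

lemma sum_mi_order_shift:
  fixes W :: "nat^3 \<Rightarrow> real"
  shows "(\<Sum>k | mi_order k = n. real (Suc (k $ i)) * W (k + axis i 1)) =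
    (\<Sum>k | mi_order k = Suc n. real (k $ i) * W k)"
proof -
  have "(\<Sum>k | mi_order k = Suc n. real (k $ i) * W k)
     = (\<Sum>k \<in> (\<lambda>k. k + axis i 1) ` {k. mi_order k = n}. real (k $ i) * W k)"
  proof (rule sum.mono_neutral_right[OF finite_mi_order_eq])
    show "\<forall>k\<in>{k. mi_order k = Suc n} - (\<lambda>k. k + axis i 1) ` {k. mi_order k = n}. real (k $ i) * W k = 0"
    proof (intro ballI, rule ccontr)
      fix k assume k: "k \<in> {k. mi_order k = Suc n} - (\<lambda>k. k + axis i 1) ` {k. mi_order k = n}"
        and nz: "real (k $ i) * W k \<noteq> 0"
      from k have order: "mi_order k = Suc n" by blast
      from nz have pos: "k $ i > 0" by simp
      define l where "l = (\<chi> j. if j = i then k $ i - 1 else k $ j)"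
      have l: "k = l + axis i 1"
        using pos by (simp add: l_def vec_eq_iff axis_def)
      then have "mi_order l = n"
        using order mi_order_add_axis[of l i] by simp
      with l have "k \<in> (\<lambda>k. k + axis i 1) ` {k. mi_order k = n}" by (intro image_eqI[of _ _ l]) auto
      with k show False by simp
    qed
  qed (auto simp: mi_order_add_axis simp del: One_nat_def)
  also have "\<dots> = (\<Sum>k | mi_order k = n. real ((k + axis i 1) $ i) * W (k + axis i 1))"
    by (subst sum.reindex) (auto simp: inj_on_def)
  finally show ?thesis by (simp add: axis_def)
qed

text \<open>Differentiating along \<open>b\<close> replaces \<open>D\<^sup>k f\<close> by \<open>\<Sum>\<^sub>i b\<^sub>i D\<^bsup>k + e\<^sub>i\<^esup> f\<close>. The term for \<open>k\<close> and \<open>i\<close> is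
\<open>k\<^sub>i + 1\<close> times the Taylor term of \<open>k + e\<^sub>i\<close>, so each multi-index \<open>l\<close> of order \<open>n + 1\<close> is collected
\<open>l\<^sub>1 + l\<^sub>2 + l\<^sub>3 = n + 1\<close> times. Up to factorials, the layers are thus the successive derivatives of
\<open>f\<close> along the line.\<close>

lemma taylor_layer_deriv:
  assumes f: "kernel_algebra x f" and y: "y + t *\<^sub>R b \<noteq> x"
  shows "((\<lambda>t. taylor_layer f n (y + t *\<^sub>R b) b) has_real_derivative
    real (Suc n) * taylor_layer f (Suc n) (y + t *\<^sub>R b) b) (at t)"
proof -
  define W where "W k = mi_deriv k f (y + t *\<^sub>R b) / mi_fact k * mi_power b k" for k
  have D: "((\<lambda>t. mi_deriv k f (y + t *\<^sub>R b)) has_real_derivative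
      (\<Sum>i\<in>UNIV. b $ i * mi_deriv (k + axis i 1) f (y + t *\<^sub>R b))) (at t)" for k
  proof -
    have "((\<lambda>t. mi_deriv k f (y + t *\<^sub>R b)) has_derivative
      (\<lambda>s. \<Sum>i\<in>UNIV. (s *\<^sub>R b) $ i * partial i (mi_deriv k f) (y + t *\<^sub>R b))) (at t)"
      by (rule has_derivative_compose[where f="\<lambda>t. y + t *\<^sub>R b",
            OF _ kernel_algebra_has_derivative[OF kernel_algebra_mi_deriv[OF f] y]])
        (auto intro!: derivative_eq_intros)
    moreover have "(\<lambda>s. \<Sum>i\<in>UNIV. (s *\<^sub>R b) $ i * partial i (mi_deriv k f) (y + t *\<^sub>R b)) =
       (*) (\<Sum>i\<in>UNIV. b $ i * mi_deriv (k + axis i 1) f (y + t *\<^sub>R b))"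
      by (auto intro!: ext sum.cong simp: partial_mi_deriv[OF f y] sum_distrib_right simp del: One_nat_def)
    ultimately show ?thesis by (simp add: has_field_derivative_def)
  qed
  have "((\<lambda>t. taylor_layer f n (y + t *\<^sub>R b) b) has_real_derivative
    (\<Sum>k | mi_order k = n. (\<Sum>i\<in>UNIV. b $ i * mi_deriv (k + axis i 1) f (y + t *\<^sub>R b)) / mi_fact k * mi_power b k)) (at t)"
    unfolding taylor_layer_def by (intro DERIV_sum DERIV_cmult_right DERIV_cdivide D)
  also have "(\<Sum>k | mi_order k = n. (\<Sum>i\<in>UNIV. b $ i * mi_deriv (k + axis i 1) f (y + t *\<^sub>R b)) / mi_fact k * mi_power b k)
     = (\<Sum>k | mi_order k = n. \<Sum>i\<in>UNIV. real (Suc (k $ i)) * W (k + axis i 1))"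
  proof (rule sum.cong[OF refl])
    fix k
    have "real (Suc (k $ i)) * W (k + axis i 1) =
        b $ i * mi_deriv (k + axis i 1) f (y + t *\<^sub>R b) / mi_fact k * mi_power b k" for i
      unfolding W_def mi_fact_add_axis mi_power_add_axis by simp
    then show "(\<Sum>i\<in>UNIV. b $ i * mi_deriv (k + axis i 1) f (y + t *\<^sub>R b)) / mi_fact k * mi_power b k =
        (\<Sum>i\<in>UNIV. real (Suc (k $ i)) * W (k + axis i 1))"
      by (simp only: sum_divide_distrib sum_distrib_right)
  qed
  also have "\<dots> = (\<Sum>i\<in>UNIV. \<Sum>k | mi_order k = Suc n. real (k $ i) * W k)"
    by (subst sum.swap) (simp only: sum_mi_order_shift)
  also have "\<dots> = (\<Sum>k | mi_order k = Suc n. real (mi_order k) * W k)"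
    by (subst sum.swap) (simp only: mi_order_def of_nat_sum sum_distrib_right)
  also have "\<dots> = real (Suc n) * taylor_layer f (Suc n) (y + t *\<^sub>R b) b"
    by (simp add: taylor_layer_def W_def sum_distrib_left)
  finally show ?thesis .
qed

section \<open>The Legendre expansion\<close>

text \<open>The Taylor coefficients of \<open>(1 - t) powr (-1/2)\<close>.\<close>

definition half_coeff :: "nat \<Rightarrow> real" where
  "half_coeff k = pochhammer (1/2) k / fact k"

lemma half_coeff_nonneg: "half_coeff k \<ge> 0"
  by (simp add: half_coeff_def pochhammer_nonneg)

lemma half_coeff_gbinomial: "(- (1/2) :: real) gchoose k = (-1) ^ k * half_coeff k"
  by (simp add: half_coeff_def gbinomial_pochhammer)

text \<open>The square of \<open>(1 - t) powr (-1/2)\<close> is \<open>1 / (1 - t)\<close>, all of whose coefficients are 1.\<close>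

lemma half_coeff_convolution: "(\<Sum>k\<le>n. half_coeff k * half_coeff (n - k)) = 1"
proof -
  have "(- 1 :: real) gchoose n = (\<Sum>k=0..n. ((- 1/2) gchoose k) * ((- 1/2) gchoose (n - k)))"
    by (subst gbinomial_Vandermonde) simp
  also have "\<dots> = (\<Sum>k=0..n. (-1) ^ n * (half_coeff k * half_coeff (n - k)))"
  proof (rule sum.cong[OF refl])
    fix k assume "k \<in> {0..n}"
    then have "(-1 :: real) ^ n = (-1) ^ k * (-1) ^ (n - k)" by (simp flip: power_add)
    then show "((- 1/2 :: real) gchoose k) * ((- 1/2) gchoose (n - k)) =
        (-1) ^ n * (half_coeff k * half_coeff (n - k))"
      by (simp add: half_coeff_gbinomial mult_ac)
  qed
  finally have "(-1) ^ n = (-1 :: real) ^ n * (\<Sum>k\<le>n. half_coeff k * half_coeff (n - k))"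
    by (simp add: gbinomial_pochhammer pochhammer_fact atMost_atLeast0 sum_distrib_left flip: pochhammer_fact)
  then show ?thesis by simp
qed

lemma half_coeff_le_1: "half_coeff k \<le> 1"
proof -
  have "half_coeff k * half_coeff (k - k) \<le> (\<Sum>j\<le>k. half_coeff j * half_coeff (k - j))"
    by (rule member_le_sum) (auto simp: half_coeff_nonneg)
  then show ?thesis by (simp only: half_coeff_convolution) (simp add: half_coeff_def)
qed

text \<open>For \<open>z = s * exp (\<i> * \<theta>)\<close> this is \<open>s ^ n\<close> times the Legendre polynomial \<open>P\<^sub>n\<close> at \<open>cos \<theta>\<close>. In this form
\<open>|P\<^sub>n (cos \<theta>)| \<le> 1\<close> is immediate: the coefficients are nonnegative and sum to 1.\<close>

definition legendre_term :: "nat \<Rightarrow> complex \<Rightarrow> real" where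
  "legendre_term n z = (\<Sum>k\<le>n. half_coeff k * half_coeff (n - k) * Re (z ^ k * cnj z ^ (n - k)))"

lemma legendre_term_scale: "legendre_term n (of_real t * z) = t ^ n * legendre_term n z"
proof -
  have "Re ((of_real t * z) ^ k * cnj (of_real t * z) ^ (n - k)) = t ^ n * Re (z ^ k * cnj z ^ (n - k))"
    if "k \<le> n" for k
  proof -
    have "(of_real t * z) ^ k * cnj (of_real t * z) ^ (n - k)
        = of_real (t ^ k * t ^ (n - k)) * (z ^ k * cnj z ^ (n - k))"
      by (simp add: power_mult_distrib)
    with that show ?thesis by (simp flip: power_add)
  qed
  then show ?thesis by (simp add: legendre_term_def sum_distrib_left mult_ac)
qed

lemma legendre_term_bound: "\<bar>legendre_term n z\<bar> \<le> norm z ^ n"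
proof -
  have "\<bar>legendre_term n z\<bar> \<le> (\<Sum>k\<le>n. half_coeff k * half_coeff (n - k) * norm z ^ n)"
    unfolding legendre_term_def
  proof (rule order_trans[OF sum_abs sum_mono])
    fix k assume "k \<in> {..n}"
    have "\<bar>Re (z ^ k * cnj z ^ (n - k))\<bar> \<le> norm (z ^ k * cnj z ^ (n - k))"
      by (rule abs_Re_le_cmod)
    also have "\<dots> = norm z ^ n"
      using \<open>k \<in> {..n}\<close> by (simp add: norm_mult norm_power flip: power_add)
    finally show "\<bar>half_coeff k * half_coeff (n - k) * Re (z ^ k * cnj z ^ (n - k))\<bar>
        \<le> half_coeff k * half_coeff (n - k) * norm z ^ n"
      by (simp add: abs_mult half_coeff_nonneg mult_left_mono)
  qed
  also have "\<dots> = norm z ^ n"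
    by (simp add: half_coeff_convolution flip: sum_distrib_right)
  finally show ?thesis .
qed

text \<open>Write \<open>1 / |1 - z| = w * cnj w\<close> with \<open>w = (1 - z) powr (-1/2)\<close>, and take the Cauchy product of the
binomial series of \<open>w\<close> and its conjugate.\<close>

lemma legendre_term_sums:
  assumes z: "norm z < 1"
  shows "(\<lambda>n. legendre_term n z) sums inverse (norm (1 - z))"
proof -
  define w where "w = (1 - z) powr (- 1/2)"
  have coeff: "((- 1/2 :: complex) gchoose k) * (- z) ^ k = of_real (half_coeff k) * z ^ k" for k
  proof -
    have "(- 1/2 :: complex) gchoose k = of_real ((- 1/2 :: real) gchoose k)"
      by (simp add: gbinomial_prod_rev)
    then have "((- 1/2 :: complex) gchoose k) * (- z) ^ k = of_real (half_coeff k) * ((-1) ^ k * (- z) ^ k)"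
      by (simp add: half_coeff_gbinomial mult_ac)
    also have "(-1) ^ k * (- z) ^ k = z ^ k"
      by (simp flip: power_mult_distrib)
    finally show ?thesis .
  qed
  have w: "(\<lambda>k. of_real (half_coeff k) * z ^ k) sums w"
  proof -
    have "(\<lambda>k. ((- 1/2) gchoose k) * (- z) ^ k) sums (1 + - z) powr (- 1/2)"
      by (rule gen_binomial_complex) (simp add: z)
    then show ?thesis unfolding coeff w_def by simp
  qed
  then have cnj_w: "(\<lambda>k. of_real (half_coeff k) * cnj z ^ k) sums cnj w"
    using sums_cnj by force
  have summable: "summable (\<lambda>k. norm (of_real (half_coeff k) * u ^ k))" if "norm u = norm z" for u :: complex
  proof (rule summable_comparison_test')
    show "summable (\<lambda>k. norm z ^ k)" using z by (simp add: summable_geometric)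
    show "norm (norm (of_real (half_coeff k) * u ^ k)) \<le> norm z ^ k" for k
      using half_coeff_le_1[of k] half_coeff_nonneg[of k] that
      by (simp add: norm_mult norm_power mult_left_le_one_le)
  qed
  have "(\<lambda>n. \<Sum>k\<le>n. of_real (half_coeff k) * z ^ k * (of_real (half_coeff (n - k)) * cnj z ^ (n - k)))
      sums (w * cnj w)"
    using Cauchy_product_sums[OF summable[of z] summable[of "cnj z"]] w cnj_w by (simp add: sums_iff)
  then have "(\<lambda>n. Re (\<Sum>k\<le>n. of_real (half_coeff k) * z ^ k * (of_real (half_coeff (n - k)) * cnj z ^ (n - k))))
      sums Re (w * cnj w)"
    by (rule sums_Re)
  moreover have "Re (\<Sum>k\<le>n. of_real (half_coeff k) * z ^ k * (of_real (half_coeff (n - k)) * cnj z ^ (n - k)))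
      = legendre_term n z" for n
    unfolding legendre_term_def Re_sum
  proof (intro sum.cong refl)
    fix k
    have "of_real (half_coeff k) * z ^ k * (of_real (half_coeff (n - k)) * cnj z ^ (n - k))
      = of_real (half_coeff k * half_coeff (n - k)) * (z ^ k * cnj z ^ (n - k))" by simp
    then show "Re (of_real (half_coeff k) * z ^ k * (of_real (half_coeff (n - k)) * cnj z ^ (n - k)))
      = half_coeff k * half_coeff (n - k) * Re (z ^ k * cnj z ^ (n - k))"
      by (metis Re_complex_of_real mult_cancel_left scaleR_conv_of_real scaleR_complex.sel(1))
  qed
  moreover have "Re (w * cnj w) = inverse (norm (1 - z))"
  proof -
    have "Re (w * cnj w) = norm w ^ 2"
      by (metis Re_complex_of_real complex_norm_square)
    also have "norm w = norm (1 - z) powr (- 1/2)"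
      unfolding w_def by (subst norm_powr_real_powr') auto
    also have "\<dots> ^ 2 = norm (1 - z) powr (- 1)"
      by (simp add: power2_eq_square flip: powr_add)
    also have "\<dots> = inverse (norm (1 - z))"
      by (simp add: powr_minus)
    finally show ?thesis .
  qed
  ultimately show ?thesis by simp
qed

text \<open>The vectors \<open>a\<close> and \<open>b\<close> span at most a plane. Identify it with \<open>\<complex>\<close> so that \<open>a\<close> becomes the real number
\<open>|a|\<close>, and let \<open>z\<close> be the quotient \<open>b / a\<close>. Its imaginary part exists by the Cauchy--Schwarz inequality.\<close>

lemma norm_diff_as_complex:
  fixes a b :: "'a :: real_inner"
  assumes "a \<noteq> 0"
  obtains z :: complex where "norm z = norm b / norm a"
    and "\<And>t. norm (a - t *\<^sub>R b) = norm a * norm (1 - of_real t * z)"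
proof -
  define c where "c = (a \<bullet> b) / (norm a)\<^sup>2"
  define s where "s = norm b / norm a"
  have "\<bar>a \<bullet> b\<bar> \<le> norm a * norm b" by (rule Cauchy_Schwarz_ineq2)
  then have "\<bar>c\<bar> \<le> s"
    using assms by (simp add: c_def s_def abs_divide divide_simps power2_eq_square mult_ac)
  then have "c\<^sup>2 \<le> s\<^sup>2"
    by (simp add: abs_le_square_iff[symmetric])
  define z where "z = Complex c (sqrt (s\<^sup>2 - c\<^sup>2))"
  have s0: "s \<ge> 0" by (simp add: s_def)
  have nz: "norm z = s"
    using \<open>c\<^sup>2 \<le> s\<^sup>2\<close> s0 by (simp add: z_def cmod_def)
  have "norm (a - t *\<^sub>R b) = norm a * norm (1 - of_real t * z)" for t
  proof (rule power2_eq_imp_eq)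
    have "(norm (1 - of_real t * z))\<^sup>2 = (1 - t * c)\<^sup>2 + t\<^sup>2 * (s\<^sup>2 - c\<^sup>2)"
      using \<open>c\<^sup>2 \<le> s\<^sup>2\<close> by (simp add: cmod_power2 z_def power_mult_distrib)
    also have "\<dots> = 1 - 2 * t * c + t\<^sup>2 * s\<^sup>2"
      by (simp add: power2_eq_square algebra_simps)
    finally have "(norm a * norm (1 - of_real t * z))\<^sup>2 = (norm a)\<^sup>2 - 2 * t * (a \<bullet> b) + t\<^sup>2 * (norm b)\<^sup>2"
      using assms by (simp add: power_mult_distrib c_def s_def field_simps)
    also have "\<dots> = (norm (a - t *\<^sub>R b))\<^sup>2"
      unfolding power2_norm_eq_inner
      by (simp add: inner_diff_left inner_diff_right inner_commute power2_eq_square)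
    finally show "(norm (a - t *\<^sub>R b))\<^sup>2 = (norm a * norm (1 - of_real t * z))\<^sup>2" by simp
  qed auto
  with nz show ?thesis using that unfolding s_def by blast
qed

lemma inverse_dist_expansion:
  fixes a b :: "'a :: real_inner"
  assumes "a \<noteq> 0"
  obtains c :: "nat \<Rightarrow> real" where "\<And>n. \<bar>c n\<bar> \<le> (norm b / norm a) ^ n"
    and "\<And>t. \<bar>t\<bar> * norm b < norm a \<Longrightarrow> (\<lambda>n. c n * t ^ n) sums (norm a * inverse (norm (a - t *\<^sub>R b)))"
proof -
  obtain z :: complex where z: "norm z = norm b / norm a"
    and nz: "\<And>t. norm (a - t *\<^sub>R b) = norm a * norm (1 - of_real t * z)"
    using norm_diff_as_complex[OF assms] by metis
  show ?thesis
  proof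
    show "\<bar>legendre_term n z\<bar> \<le> (norm b / norm a) ^ n" for n
      using legendre_term_bound[of n z] z by simp
    fix t :: real assume "\<bar>t\<bar> * norm b < norm a"
    then have "norm (of_real t * z) < 1"
      using assms by (simp add: norm_mult z)
    then have "(\<lambda>n. t ^ n * legendre_term n z) sums inverse (norm (1 - of_real t * z))"
      using legendre_term_sums by (simp only: legendre_term_scale[symmetric])
    moreover have "norm a * inverse (norm (a - t *\<^sub>R b)) = inverse (norm (1 - of_real t * z))"
      using assms by (simp add: nz)
    ultimately show "(\<lambda>n. legendre_term n z * t ^ n) sums (norm a * inverse (norm (a - t *\<^sub>R b)))"
      by (simp only: mult.commute)
  qed
qed

lemma geometric_tail_bound:
  fixes c :: "nat \<Rightarrow> real"
  assumes "\<And>n. \<bar>c n\<bar> \<le> s ^ n" and "0 \<le> s" "s < 1" and "c sums S"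
  shows "\<bar>S - (\<Sum>n\<le>p. c n)\<bar> \<le> s ^ (p + 1) / (1 - s)"
proof -
  have tail: "(\<lambda>n. c (n + (p + 1))) sums (S - (\<Sum>n\<le>p. c n))"
    using sums_split_initial_segment[OF assms(4), of "p + 1"] by (simp add: lessThan_Suc_atMost)
  have geo: "(\<lambda>n. s ^ (p + 1) * s ^ n) sums (s ^ (p + 1) * (1 / (1 - s)))"
    using assms(2,3) by (intro sums_mult geometric_sums) simp
  have le: "\<bar>c (n + (p + 1))\<bar> \<le> s ^ (p + 1) * s ^ n" for n
    using assms(1)[of "n + (p + 1)"] by (simp add: power_add mult_ac)
  have "S - (\<Sum>n\<le>p. c n) \<le> s ^ (p + 1) / (1 - s)"
    using sums_le[OF _ tail geo] le by (simp add: abs_le_iff)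
  moreover have "- (S - (\<Sum>n\<le>p. c n)) \<le> s ^ (p + 1) / (1 - s)"
    using sums_le[OF _ sums_minus[OF tail] geo] le by (simp add: abs_le_iff)
  ultimately show ?thesis by (simp add: abs_le_iff)
qed

text \<open>Identifies the coefficients of a power series without naming higher derivatives of its sum: any chain of
functions, each the derivative of the one before, will do. The Taylor layers along a line form such a chain.\<close>

lemma derivative_chain_coeff:
  fixes U :: "nat \<Rightarrow> real \<Rightarrow> real"
  assumes "e > 0"
    and "\<And>n t. \<bar>t\<bar> < e \<Longrightarrow> (U n has_real_derivative U (Suc n) t) (at t)"
    and "\<And>t. \<bar>t\<bar> < e \<Longrightarrow> (\<lambda>n. c n * t ^ n) sums U 0 t"
  shows "U n 0 = fact n * c n"
  using assms(2,3)
proof (induction n arbitrary: U c)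
  case 0
  show ?case using 0(2)[of 0] \<open>e > 0\<close> by (simp add: sums_unique2)
next
  case (Suc n)
  \<comment> \<open>The shifted chain is represented by the differentiated series, so the hypothesis applies to it.\<close>
  have "(\<lambda>n. diffs c n * t ^ n) sums U (Suc 0) t" if "\<bar>t\<bar> < e" for t
    by (rule termdiffs_sums_strong[where K=e and f="U 0"]) (use Suc.prems that in auto)
  with Suc.IH[of "\<lambda>n. U (Suc n)" "diffs c"] Suc.prems(1) show ?case
    by (simp add: diffs_def mult_ac)
qed

section \<open>The pointwise remainder of the multipole expansion\<close>

lemma kernel_algebra_G: "kernel_algebra x (G x)"
proof -
  have "kernel_algebra x (\<lambda>y. (1 / (4 * pi)) * inverse (norm (y - x)))"
    by (intro kernel_algebra.intros(1-5))
  then show ?thesis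
    by (rule kernel_algebra.cong) (simp add: G_def norm_minus_commute divide_simps)
qed

lemma taylor_layer_0: "taylor_layer f 0 y b = f y"
proof -
  have "{k. mi_order k = 0} = {0}"
    by (auto simp: mi_order_def vec_eq_iff)
  then show ?thesis
    by (simp add: taylor_layer_def mi_deriv_def mi_fact_def mi_power_def)
qed

lemma multipole_taylor_layers:
  "multipole p x yc y = (\<Sum>n\<le>p. taylor_layer (G x) n yc (y - yc))"
proof -
  have "(\<Sum>n\<le>p. taylor_layer (G x) n yc (y - yc)) =
     (\<Sum>n\<le>p. \<Sum>k\<in>{k \<in> {k. mi_order k \<le> p}. mi_order k = n}.
        multipole_coeff k x yc * mi_power (y - yc) k)"
    unfolding taylor_layer_def
    by (intro sum.cong refl) (auto simp: multipole_coeff_def)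
  also have "\<dots> = multipole p x yc y"
    unfolding multipole_def by (rule sum.group) (auto simp: finite_mi_order_le)
  finally show ?thesis by simp
qed

text \<open>On the segment from \<open>yc\<close> to \<open>y\<close>, the kernel is a power series in the parameter whose \<open>n\<close>-th coefficient
is at most \<open>s ^ n\<close> times \<open>1 / (4 * pi * |x - yc|)\<close>. The Taylor layers of \<open>G x\<close> at \<open>yc\<close> are
the terms of this series at parameter 1, so the remainder is a tail of a series dominated by a geometric one.\<close>

lemma multipole_remainder:
  assumes "norm (y - yc) < norm (x - yc)"
  defines "s \<equiv> norm (y - yc) / norm (x - yc)"
  shows "\<bar>G x y - multipole p x yc y\<bar> \<le> s ^ (p + 1) / (4 * pi * norm (x - yc) * (1 - s))"
proof -
  define a where "a = x - yc"
  define b where "b = y - yc"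
  have a: "norm a > 0" and ab: "norm b < norm a"
    using assms(1) norm_ge_zero[of "y - yc"] unfolding a_def b_def by linarith+
  obtain c :: "nat \<Rightarrow> real" where c: "\<And>n. \<bar>c n\<bar> \<le> (norm b / norm a) ^ n"
    and sums: "\<And>t. \<bar>t\<bar> * norm b < norm a \<Longrightarrow>
       (\<lambda>n. c n * t ^ n) sums (norm a * inverse (norm (a - t *\<^sub>R b)))"
    using inverse_dist_expansion[of a b] a by auto
  define d where "d n = c n / (4 * pi * norm a)" for n
  have G: "G x (yc + t *\<^sub>R b) = norm a * inverse (norm (a - t *\<^sub>R b)) / (4 * pi * norm a)" for t
    using a by (simp add: G_def a_def algebra_simps divide_simps)
  have small: "\<bar>t\<bar> * norm b < norm a" if "\<bar>t\<bar> \<le> 1" for t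
    using mult_right_mono[OF that, of "norm b"] ab by simp
  have d: "(\<lambda>n. d n * t ^ n) sums G x (yc + t *\<^sub>R b)" if "\<bar>t\<bar> \<le> 1" for t
    using sums_divide[OF sums[OF small[OF that]], of "4 * pi * norm a"] by (simp add: G d_def)
  have off: "yc + t *\<^sub>R b \<noteq> x" if "\<bar>t\<bar> \<le> 1" for t
  proof
    assume "yc + t *\<^sub>R b = x"
    then have "norm a = \<bar>t\<bar> * norm b" by (auto simp: a_def)
    with small[OF that] show False by simp
  qed
  have "fact n * taylor_layer (G x) n (yc + 0 *\<^sub>R b) b = fact n * d n" for n
  proof (rule derivative_chain_coeff[of 1 "\<lambda>n t. fact n * taylor_layer (G x) n (yc + t *\<^sub>R b) b"])
    fix n and t :: real assume "\<bar>t\<bar> < 1"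
    then show "((\<lambda>t. fact n * taylor_layer (G x) n (yc + t *\<^sub>R b) b) has_real_derivative
         fact (Suc n) * taylor_layer (G x) (Suc n) (yc + t *\<^sub>R b) b) (at t)"
      using DERIV_cmult[OF taylor_layer_deriv[OF kernel_algebra_G off], of t "fact n" n]
      by (simp add: mult_ac)
  qed (use d in \<open>auto simp: taylor_layer_0\<close>)
  then have layer: "taylor_layer (G x) n yc b = d n" for n by simp
  have s: "norm b / norm a = s" by (simp add: s_def a_def b_def)
  have "(\<lambda>n. c n) sums (4 * pi * norm a * G x y)"
    using sums[of 1] ab G[of 1] a by (simp add: b_def)
  then have "\<bar>4 * pi * norm a * G x y - (\<Sum>n\<le>p. c n)\<bar> \<le> s ^ (p + 1) / (1 - s)"
    using c ab a by (intro geometric_tail_bound) (auto simp: s[symmetric])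
  moreover have "4 * pi * norm a * G x y - (\<Sum>n\<le>p. c n) = 4 * pi * norm a * (G x y - multipole p x yc y)"
    using a by (simp add: multipole_taylor_layers layer b_def[symmetric] d_def
        right_diff_distrib sum_divide_distrib[symmetric])
  ultimately have "4 * pi * norm a * \<bar>G x y - multipole p x yc y\<bar> \<le> s ^ (p + 1) / (1 - s)"
    using a by (simp add: abs_mult)
  then have "\<bar>G x y - multipole p x yc y\<bar> \<le> s ^ (p + 1) / (1 - s) / (4 * pi * norm a)"
    using a by (subst pos_le_divide_eq) (auto simp: mult_ac)
  then show ?thesis by (simp add: a_def mult_ac)
qed

text \<open>The bound increases with the ratio of the distances, so that one value of the ratio serves for all
points of an element.\<close>

lemma multipole_remainder_radius:
  assumes "norm (y - yc) \<le> r * norm (x - yc)" and "0 \<le> r" "r < 1" and "x \<noteq> yc"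
  shows "\<bar>G x y - multipole p x yc y\<bar> \<le> r ^ (p + 1) / (4 * pi * norm (x - yc) * (1 - r))"
proof -
  let ?s = "norm (y - yc) / norm (x - yc)"
  have R: "norm (x - yc) > 0" using assms(4) by simp
  have s: "?s \<le> r" using assms(1) R by (simp add: divide_le_eq)
  have "norm (y - yc) < norm (x - yc)"
    using s R assms(3) by (metis divide_less_eq_1_pos le_less_trans)
  then have "\<bar>G x y - multipole p x yc y\<bar> \<le> ?s ^ (p + 1) / (4 * pi * norm (x - yc) * (1 - ?s))"
    by (rule multipole_remainder)
  also have "\<dots> \<le> r ^ (p + 1) / (4 * pi * norm (x - yc) * (1 - r))"
    using R s assms by (intro frac_le power_mono mult_left_mono) auto
  finally show ?thesis .
qed

lemma continuous_on_multipole: "continuous_on S (multipole p x yc)"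
  unfolding multipole_def mi_power_def by (intro continuous_intros)

section \<open>Integrability and additivity over elements\<close>

lemma G_nonneg: "G x y \<ge> 0"
  by (simp add: G_def)

lemma borel_measurable_G: "G x \<in> borel_measurable lborel"
  unfolding G_def[abs_def] by measurable

lemma inverse_dist_shell:
  assumes "0 < d" "d \<le> R"
  obtains n where "d \<le> R / 2 ^ n" and "1 / d \<le> 2 ^ (n + 1) / (R :: real)"
proof -
  have R: "R > 0" using assms by linarith
  have "\<exists>n. R / 2 ^ (n + 1) < d"
  proof -
    obtain n where "R / d < 2 ^ n" using real_arch_pow[of 2 "R / d"] by auto
    then have "R / 2 ^ n < d" using assms by (simp add: field_simps)
    moreover have "R / 2 ^ (n + 1) \<le> R / 2 ^ n" using R by (simp add: field_simps)
    ultimately show ?thesis by (intro exI[of _ n]) linarith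
  qed
  then obtain n where n: "R / 2 ^ (n + 1) < d" "\<And>m. m < n \<Longrightarrow> \<not> R / 2 ^ (m + 1) < d"
    using exists_least_iff[of "\<lambda>n. R / 2 ^ (n + 1) < d"] by metis
  have "d \<le> R / 2 ^ n"
    using n(2)[of "n - 1"] assms(2) by (cases n) auto
  moreover have "1 / d \<le> 2 ^ (n + 1) / R"
    using n(1) assms R by (simp add: field_simps)
  ultimately show ?thesis using that by blast
qed

text \<open>The kernel is integrable across its singularity. On the shell \<open>R / 2 ^ (n + 1) < |x - y| \<le> R / 2 ^ n\<close> it is at
most \<open>2 ^ (n + 1) / R\<close>, while the volume of the ball containing the shell is of order \<open>R\<^sup>3 / 8 ^ n\<close>.
The contributions thus decay like \<open>1 / 4 ^ n\<close>.\<close>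

lemma G_integrable_on_cball:
  assumes "R > 0"
  shows "set_integrable lebesgue (cball x R) (G x)"
proof -
  let ?g = "\<lambda>y. indicator (cball x R) y *\<^sub>R G x y"
  define v where "v = unit_ball_vol (real DIM(real^3))"
  have v: "v \<ge> 0" by (simp add: v_def)
  have g: "?g \<in> borel_measurable lborel"
    by (intro borel_measurable_scaleR borel_measurable_G borel_measurable_indicator) simp
  have pointwise: "ennreal (norm (?g y)) \<le>
      (\<Sum>n. ennreal (2 ^ (n + 1) / R) * indicator (cball x (R / 2 ^ n)) y)" for y
  proof (cases "y = x \<or> y \<notin> cball x R")
    case True
    then show ?thesis by (auto simp: G_def)
  next
    case False
    then have "0 < norm (x - y)" "norm (x - y) \<le> R" by (auto simp: dist_norm)
    then obtain n where n: "norm (x - y) \<le> R / 2 ^ n" "1 / norm (x - y) \<le> 2 ^ (n + 1) / R"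
      by (rule inverse_dist_shell)
    have "G x y \<le> 1 / norm (x - y)"
    proof -
      have "1 \<le> 4 * pi" using pi_gt3 by simp
      then have "norm (x - y) \<le> 4 * pi * norm (x - y)"
        using mult_right_mono[of 1 "4 * pi" "norm (x - y)"] by simp
      then show ?thesis
        unfolding G_def using \<open>0 < norm (x - y)\<close> by (intro divide_left_mono) auto
    qed
    then have "norm (?g y) \<le> 2 ^ (n + 1) / R"
      using n(2) False by (simp add: G_nonneg)
    then have "ennreal (norm (?g y)) \<le> ennreal (2 ^ (n + 1) / R) * indicator (cball x (R / 2 ^ n)) y"
      using n(1) by (simp add: dist_norm ennreal_leI)
    also have "\<dots> \<le> (\<Sum>k. ennreal (2 ^ (k + 1) / R) * indicator (cball x (R / 2 ^ k)) y)"
    proof -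
      have "h n \<le> (\<Sum>k. h k)" for h :: "nat \<Rightarrow> ennreal"
        using sum_le_suminf[of h "{n}"] by simp
      then show ?thesis .
    qed
    finally show ?thesis .
  qed
  have shell: "ennreal (2 ^ (n + 1) / R) * emeasure lborel (cball x (R / 2 ^ n)) =
      ennreal (2 * v * R\<^sup>2 * (1 / 4) ^ n)" for n
  proof -
    have "2 ^ (n + 1) / R * (v * (R / 2 ^ n) ^ 3) = 2 * v * R\<^sup>2 * (1 / 4) ^ n"
    proof -
      have "(1 / 4 :: real) ^ n = 1 / (2 ^ n * 2 ^ n)"
        by (simp add: power_one_over flip: power_mult_distrib)
      moreover have "2 * q / R * (v * (R / q) ^ 3) = 2 * v * R\<^sup>2 * (1 / (q * q))" if "q > 0" for q
        using assms that by (simp add: power2_eq_square power3_eq_cube)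
      ultimately show ?thesis by simp
    qed
    moreover have "emeasure lborel (cball x (R / 2 ^ n)) = ennreal (v * (R / 2 ^ n) ^ 3)"
      using assms by (subst emeasure_cball) (auto simp: v_def)
    ultimately show ?thesis using assms v by (simp flip: ennreal_mult)
  qed
  have "(\<integral>\<^sup>+ y. ennreal (norm (?g y)) \<partial>lborel) \<le>
      (\<integral>\<^sup>+ y. (\<Sum>n. ennreal (2 ^ (n + 1) / R) * indicator (cball x (R / 2 ^ n)) y) \<partial>lborel)"
    by (rule nn_integral_mono) (rule pointwise)
  also have "\<dots> = (\<Sum>n. ennreal (2 ^ (n + 1) / R) * emeasure lborel (cball x (R / 2 ^ n)))"
    by (subst nn_integral_suminf)
      (auto simp: nn_integral_cmult_indicator intro!: borel_measurable_times_ennreal borel_measurable_indicator)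
  also have "\<dots> = ennreal (\<Sum>n. 2 * v * R\<^sup>2 * (1 / 4) ^ n)"
    unfolding shell using v by (intro suminf_ennreal2 summable_mult summable_geometric) simp_all
  also have "\<dots> < \<infinity>" by simp
  finally have "integrable lborel ?g"
    by (intro integrableI_bounded g)
  then show ?thesis
    unfolding set_integrable_def using integrable_completion[OF g] by simp
qed

lemma set_integrable_mult_dominated:
  fixes \<phi> f g :: "real^3 \<Rightarrow> real"
  assumes "\<phi> \<in> borel_measurable lborel" and "set_borel_measurable lebesgue A f"
    and "set_integrable lebesgue A g" and "\<And>y. y \<in> A \<Longrightarrow> \<bar>\<phi> y * f y\<bar> \<le> g y"
  shows "set_integrable lebesgue A (\<lambda>y. \<phi> y * f y)"
proof (rule set_integrable_bound[OF assms(3)])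
  have "(\<lambda>y. \<phi> y * (indicator A y *\<^sub>R f y)) \<in> borel_measurable lebesgue"
    using measurable_completion[OF assms(1)] assms(2) unfolding set_borel_measurable_def
    by (rule borel_measurable_times)
  then show "set_borel_measurable lebesgue A (\<lambda>y. \<phi> y * f y)"
    by (simp add: set_borel_measurable_def mult_ac)
  show "AE y in lebesgue. y \<in> A \<longrightarrow> norm (\<phi> y * f y) \<le> norm (g y)"
    using assms(4) by (intro AE_I2) fastforce
qed

lemma G_source_integrable:
  assumes "bounded A" and "A \<in> sets lebesgue" and "set_borel_measurable lebesgue A f"
    and "\<And>y. y \<in> A \<Longrightarrow> \<bar>f y\<bar> \<le> F"
  shows "set_integrable lebesgue A (\<lambda>y. G x y * f y)"
proof (rule set_integrable_mult_dominated[OF borel_measurable_G assms(3)])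
  obtain R where R: "R > 0" "A \<subseteq> cball x R"
  proof -
    obtain e where e: "\<forall>y\<in>A. dist x y \<le> e" using assms(1) bounded_any_center by blast
    show ?thesis by (rule that[of "max e 1"]) (use e in \<open>auto simp: max_def\<close>)
  qed
  have "set_integrable lebesgue A (G x)"
    by (rule set_integrable_subset[OF G_integrable_on_cball[OF R(1)] assms(2) R(2)])
  then show "set_integrable lebesgue A (\<lambda>y. G x y * F)" by simp
  show "\<bar>G x y * f y\<bar> \<le> G x y * F" if "y \<in> A" for y
    using assms(4)[OF that] G_nonneg[of x y] by (simp add: abs_mult mult_left_mono)
qed

lemma negligible_convex_Int:
  fixes K L :: "'a :: euclidean_space set"
  assumes "convex K" "convex L" "interior K \<inter> interior L = {}"
  shows "negligible (K \<inter> L)"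
  using assms by (simp add: negligible_convex_interior convex_Int)

text \<open>Convex sets with disjoint interiors meet in a convex set with empty interior, which is negligible. Integrals
over them are therefore additive although the sets may share boundary points.\<close>

lemma set_integral_nonoverlapping:
  fixes g :: "'a :: euclidean_space \<Rightarrow> real"
  assumes "finite \<N>" and "finite \<F>" and "\<N> \<inter> \<F> = {}"
    and "\<And>K. K \<in> \<N> \<union> \<F> \<Longrightarrow> convex K \<and> compact K"
    and "pairwise (\<lambda>K L. interior K \<inter> interior L = {}) (\<N> \<union> \<F>)"
    and "set_integrable lebesgue (\<Union>(\<N> \<union> \<F>)) g"
  shows "(LINT y : \<Union>(\<N> \<union> \<F>) | lebesgue. g y) =
    (LINT y : \<Union>\<N> | lebesgue. g y) + (\<Sum>K\<in>\<F>. LINT y : K | lebesgue. g y)"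
  using assms(2-6)
proof (induction \<F>)
  case (insert K \<F>)
  let ?U = "\<Union>(\<N> \<union> \<F>)"
  have K: "convex K" "compact K" using insert.prems(2) by auto
  have meas: "L \<in> sets lebesgue" if "L \<in> \<N> \<union> insert K \<F>" for L
    using insert.prems(2)[OF that] lmeasurable_compact fmeasurableD by blast
  have U: "?U \<in> sets lebesgue"
    using assms(1) insert.hyps(1) meas by (intro sets.finite_Union) auto
  have "negligible (\<Union>L\<in>\<N> \<union> \<F>. L \<inter> K)"
  proof (rule negligible_Union, goal_cases)
    case (2 T)
    then obtain L where L: "T = L \<inter> K" "L \<in> \<N> \<union> \<F>" by auto
    then have "L \<noteq> K" using insert.hyps insert.prems(1) by auto
    with L show ?case
      using insert.prems(2) pairwiseD[OF insert.prems(3), of L K] by (auto intro!: negligible_convex_Int)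
  qed (use assms(1) insert.hyps in auto)
  then have "AE y in lebesgue. y \<notin> (\<Union>L\<in>\<N> \<union> \<F>. L \<inter> K)"
    by (intro AE_not_in) (simp add: negligible_iff_null_sets)
  then have ae: "AE y in lebesgue. \<not> (y \<in> ?U \<and> y \<in> K)"
    by eventually_elim auto
  have int: "set_integrable lebesgue ?U g" "set_integrable lebesgue K g"
    by (rule set_integrable_subset[OF insert.prems(4)]; use U meas in auto)+
  have "(LINT y : \<Union>(\<N> \<union> insert K \<F>) | lebesgue. g y) = (LINT y : ?U \<union> K | lebesgue. g y)"
    by (simp add: Un_commute)
  also have "\<dots> = (LINT y : ?U | lebesgue. g y) + (LINT y : K | lebesgue. g y)"
    by (rule set_integral_Un_AE[OF ae U meas int]) simp
  also have "(LINT y : ?U | lebesgue. g y) =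
      (LINT y : \<Union>\<N> | lebesgue. g y) + (\<Sum>K\<in>\<F>. LINT y : K | lebesgue. g y)"
    using insert.prems int(1) by (intro insert.IH) (auto intro: pairwise_subset)
  finally show ?case using insert.hyps by simp
qed simp

section \<open>The error of the treecode\<close>

lemma norm_le_max_radius:
  assumes "compact K" and "y \<in> K"
  shows "norm (y - barycenter K) \<le> max_radius K"
  unfolding max_radius_def
proof (rule cSUP_upper[OF assms(2)])
  have "compact ((\<lambda>y. norm (y - barycenter K)) ` K)"
    by (intro compact_continuous_image assms continuous_intros)
  then show "bdd_above ((\<lambda>y. norm (y - barycenter K)) ` K)"
    by (intro bounded_imp_bdd_above compact_imp_bounded)
qed

lemma radius_ratio_nonneg:
  assumes "compact K" and "K \<noteq> {}"
  shows "radius_ratio x K \<ge> 0"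
proof -
  obtain y where "y \<in> K" using assms(2) by blast
  then have "0 \<le> max_radius K"
    using norm_le_max_radius[OF assms(1)] norm_ge_zero order_trans by blast
  then show ?thesis by (simp add: radius_ratio_def target_dist_def)
qed

lemma element_multipole_error:
  fixes f :: "real^3 \<Rightarrow> real"
  assumes K: "compact K" "K \<noteq> {}" and R: "target_dist x K > 0" and r: "radius_ratio x K < 1"
    and f: "set_borel_measurable lebesgue K f" "\<And>y. y \<in> K \<Longrightarrow> \<bar>f y\<bar> \<le> F"
  shows "\<bar>(LINT y : K | lebesgue. G x y * f y) - (LINT y : K | lebesgue. multipole p x (barycenter K) y * f y)\<bar>
    \<le> F / (4 * pi) * (radius_ratio x K ^ (p + 1) * measure lebesgue K / (target_dist x K * (1 - radius_ratio x K)))"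
proof -
  let ?M = "multipole p x (barycenter K)"
  define B where "B = radius_ratio x K ^ (p + 1) / (4 * pi * target_dist x K * (1 - radius_ratio x K))"
  have lm: "K \<in> lmeasurable" using K(1) by (rule lmeasurable_compact)
  have mr: "max_radius K = radius_ratio x K * target_dist x K"
    using R by (simp add: radius_ratio_def)
  have r0: "radius_ratio x K \<ge> 0" using K by (rule radius_ratio_nonneg)
  obtain y0 where y0: "y0 \<in> K" using K(2) by blast
  have F: "F \<ge> 0" using f(2)[OF y0] by linarith
  have diff: "\<bar>G x y - ?M y\<bar> \<le> B" if "y \<in> K" for y
    unfolding B_def target_dist_def
    using norm_le_max_radius[OF K(1) that] mr r r0 R
    by (intro multipole_remainder_radius) (auto simp: target_dist_def)
  have bound: "\<bar>(G x y - ?M y) * f y\<bar> \<le> B * F" if "y \<in> K" for y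
    using diff[OF that] f(2)[OF that] F by (auto simp: abs_mult intro!: mult_mono order_trans[OF abs_ge_zero])
  have const: "set_integrable lebesgue K (\<lambda>y. c)" for c :: real
    using lm by (auto simp: set_integrable_def fmeasurable_def intro!: integrable_real_indicator)
  have Gf: "set_integrable lebesgue K (\<lambda>y. G x y * f y)"
    using G_source_integrable[OF compact_imp_bounded[OF K(1)] fmeasurableD[OF lm] f] .
  \<comment> \<open>Integrability of \<open>M * f\<close> is obtained from that of \<open>G * f\<close> and of the difference, which is bounded on \<open>K\<close>.\<close>
  have D: "set_integrable lebesgue K (\<lambda>y. (G x y - ?M y) * f y)"
  proof (rule set_integrable_mult_dominated[OF _ f(1) const bound])
    have "?M \<in> borel_measurable lborel"
      using borel_measurable_continuous_onI[OF continuous_on_multipole] by simp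
    then show "(\<lambda>y. G x y - ?M y) \<in> borel_measurable lborel"
      by (intro borel_measurable_diff borel_measurable_G)
  qed
  have Mf: "set_integrable lebesgue K (\<lambda>y. ?M y * f y)"
    using set_integral_diff(1)[OF Gf D] by (simp add: algebra_simps)
  have "(LINT y : K | lebesgue. G x y * f y) - (LINT y : K | lebesgue. ?M y * f y)
      = (LINT y : K | lebesgue. (G x y - ?M y) * f y)"
    by (subst set_integral_diff(2)[OF Gf Mf, symmetric]) (simp add: left_diff_distrib)
  moreover have "\<bar>LINT y : K | lebesgue. (G x y - ?M y) * f y\<bar> \<le> B * F * measure lebesgue K"
  proof -
    have c: "(LINT y : K | lebesgue. c) = c * measure lebesgue K" for c :: real
      using lm by (subst set_integral_const) (auto simp: fmeasurable_def)
    have "(LINT y : K | lebesgue. (G x y - ?M y) * f y) \<le> (LINT y : K | lebesgue. B * F)"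
      using bound by (intro set_integral_mono D const) (simp add: abs_le_iff)
    moreover have "(LINT y : K | lebesgue. - (B * F)) \<le> (LINT y : K | lebesgue. (G x y - ?M y) * f y)"
      using bound by (intro set_integral_mono D const) (simp add: abs_le_iff minus_le_iff)
    ultimately show ?thesis by (simp only: c) (simp add: abs_le_iff)
  qed
  moreover have "B * F * measure lebesgue K = F / (4 * pi) *
     (radius_ratio x K ^ (p + 1) * measure lebesgue K / (target_dist x K * (1 - radius_ratio x K)))"
    by (simp add: B_def mult_ac)
  ultimately show ?thesis by simp
qed

text \<open>The near field is integrated exactly, so it cancels against the same part of the integral over \<open>\<Omega>\<close>.\<close>

lemma treecode_error_le_sum:
  fixes f :: "real^3 \<Rightarrow> real"
  assumes S: "tet_partition \<S> \<Omega>"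
    and f: "set_borel_measurable lebesgue \<Omega> f" "\<And>y. y \<in> \<Omega> \<Longrightarrow> \<bar>f y\<bar> \<le> F"
  shows "treecode_error p \<Omega> f \<S> x \<le> (\<Sum>K\<in>far_elements x \<S>.
    \<bar>(LINT y : K | lebesgue. G x y * f y) - (LINT y : K | lebesgue. multipole p x (barycenter K) y * f y)\<bar>)"
proof -
  let ?N = "near_elements x \<S>" and ?F = "far_elements x \<S>"
  have fin: "finite \<S>" and simplex: "\<And>K. K \<in> \<S> \<Longrightarrow> 3 simplex K"
    and disj: "pairwise (\<lambda>K L. interior K \<inter> interior L = {}) \<S>" and \<Omega>: "\<Union>\<S> = \<Omega>"
    using S by (auto simp: tet_partition_def)
  have split: "?N \<union> ?F = \<S>" "?N \<inter> ?F = {}" by (auto simp: near_elements_def far_elements_def)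
  have "compact \<Omega>"
    unfolding \<Omega>[symmetric] by (rule compact_Union[OF fin]) (use simplex compact_simplex in blast)
  then have "set_integrable lebesgue \<Omega> (\<lambda>y. G x y * f y)"
    by (intro G_source_integrable[OF _ _ f] compact_imp_bounded fmeasurableD lmeasurable_compact)
  then have "(LINT y : \<Omega> | lebesgue. G x y * f y) =
    (LINT y : \<Union>?N | lebesgue. G x y * f y) + (\<Sum>K\<in>?F. LINT y : K | lebesgue. G x y * f y)"
    using set_integral_nonoverlapping[of ?N ?F "\<lambda>y. G x y * f y", unfolded split(1) \<Omega>]
      fin simplex disj split
    by (metis (no_types, lifting) convex_simplex compact_simplex finite_Un)
  then have "treecode_error p \<Omega> f \<S> x = \<bar>\<Sum>K\<in>?F. (LINT y : K | lebesgue. G x y * f y) -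
     (LINT y : K | lebesgue. multipole p x (barycenter K) y * f y)\<bar>"
    by (simp add: treecode_error_def treecode_def sum_subtractf)
  then show ?thesis by (simp add: sum_abs)
qed

theorem theorem3p1:
  fixes \<Omega> :: "(real^3) set" and f :: "real^3 \<Rightarrow> real" and F :: real
  assumes "F > 0"
    and "set_borel_measurable lebesgue \<Omega> f"
    and "\<And>y. y \<in> \<Omega> \<Longrightarrow> \<bar>f y\<bar> \<le> F"
  shows "\<exists>C::real. C > 0 \<and>
    (\<forall>(h::real) \<T> (m::nat) level x \<S> (p::nat).
       tet_mesh \<Omega> h \<T> \<longrightarrow> octree \<Omega> \<T> m level \<longrightarrow>
       x \<in> barycenter ` \<T> \<longrightarrow> source_elements \<Omega> m level \<S> \<longrightarrow>
       ereal (treecode_error p \<Omega> f \<S> x)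
         \<le> ereal C * \<bar>\<Sum>K\<in>far_elements x \<S>. bound_term p x K\<bar>)"
proof -
  \<comment> \<open>\<open>F\<close> bounds the source and \<open>1 / (4 * pi)\<close> is the normalization of the kernel; neither depends on \<open>p\<close>.\<close>
  define C where "C = F / (4 * pi)"
  have C: "C > 0" using assms(1) by (simp add: C_def)
  have "ereal (treecode_error p \<Omega> f \<S> x) \<le> ereal C * \<bar>\<Sum>K\<in>far_elements x \<S>. bound_term p x K\<bar>"
    if "source_elements \<Omega> m level \<S>" for m level x \<S> p
  proof -
    let ?F = "far_elements x \<S>"
    have S: "tet_partition \<S> \<Omega>" using that by (simp add: source_elements_def)
    then have fin: "finite \<S>" and simplex: "\<And>K. K \<in> \<S> \<Longrightarrow> 3 simplex K" and \<Omega>: "\<Union>\<S> = \<Omega>"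
      by (auto simp: tet_partition_def)
    have finF: "finite ?F" using fin by (simp add: far_elements_def)
    show ?thesis
    proof (cases "\<exists>K\<in>?F. radius_ratio x K = 1")
      case True
      \<comment> \<open>One infinite term makes the sum infinite, as no term is \<open>-\<infinity>\<close>.\<close>
      then have "(\<Sum>K\<in>?F. bound_term p x K) = \<infinity>"
        using finF by (auto simp: sum_Pinfty bound_term_def)
      then show ?thesis using C by simp
    next
      case False
      define b where "b K = radius_ratio x K ^ (p + 1) * measure lebesgue K /
        (target_dist x K * (1 - radius_ratio x K))" for K
      have b: "\<bar>(LINT y : K | lebesgue. G x y * f y) - (LINT y : K | lebesgue. multipole p x (barycenter K) y * f y)\<bar>
          \<le> C * b K" "0 \<le> b K" if "K \<in> ?F" for K
      proof -
        have KS: "K \<in> \<S>" and R: "target_dist x K > 0" and r: "radius_ratio x K < 1"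
          using that False by (auto simp: far_elements_def less_le)
        have sub: "K \<subseteq> \<Omega>" using KS \<Omega> by auto
        have K: "compact K" "K \<noteq> {}" using simplex[OF KS] by (auto simp: compact_simplex)
        have "set_borel_measurable lebesgue K f"
          by (rule set_borel_measurable_subset[OF assms(2) fmeasurableD[OF lmeasurable_compact[OF K(1)]] sub])
        note err = element_multipole_error[OF K R r this, of F]
        show "\<bar>(LINT y : K | lebesgue. G x y * f y) - (LINT y : K | lebesgue. multipole p x (barycenter K) y * f y)\<bar>
          \<le> C * b K"
          using err[of p] sub assms(3) by (auto simp: C_def b_def)
        show "0 \<le> b K"
          using radius_ratio_nonneg[OF K] R r by (simp add: b_def)
      qed
      have "treecode_error p \<Omega> f \<S> x \<le> (\<Sum>K\<in>?F. C * b K)"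
        by (rule order_trans[OF treecode_error_le_sum[OF S assms(2,3)] sum_mono[OF b(1)]])
      also have "\<dots> = C * \<bar>\<Sum>K\<in>?F. b K\<bar>"
        using b(2) by (simp add: sum_nonneg flip: sum_distrib_left)
      finally have "treecode_error p \<Omega> f \<S> x \<le> C * \<bar>\<Sum>K\<in>?F. b K\<bar>" .
      moreover have "(\<Sum>K\<in>?F. bound_term p x K) = ereal (\<Sum>K\<in>?F. b K)"
      proof -
        have "(\<Sum>K\<in>?F. bound_term p x K) = (\<Sum>K\<in>?F. ereal (b K))"
          using False by (intro sum.cong) (auto simp: bound_term_def b_def)
        then show ?thesis by simp
      qed
      ultimately show ?thesis by simp
    qed
  qed
  with C show ?thesis by blast
qed

end
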